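(* Let $p$ be a prime number, let $A$ be a $\theta^p$-ring, let $e>0$ be an integer, and let $a\in A$ satisfy $p^e a=0$. Then $a^{p^e+p^{e-1}}=0$.
   Context: Fix a prime $p$. A $\theta^p$-ring (also called a $\lambda$-ring at $p$) is a commutative ring $A$ with $1$ equipped with a map $\theta^p\colon A\to A$ such that the map $\psi^p\colon A\to A$ defined by $\psi^p(a)=a^p-p\theta^p(a)$ is a ring homomorphism, and such that for all $a,b\in A$: $\theta^p(1)=0$; $\theta^p(a+b)=\theta^p(a)+\theta^p(b)+\sum_{j=1}^{p-1}\frac{1}{p}\binom{p}{j}a^jb^{p-j}$; $\theta^p(ab)=\theta^p(a)\psi^p(b)+a^p\theta^p(b)$; $\theta^p\psi^p(a)=\psi^p\theta^p(a)$. *)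

theory Defs
  imports "HOL-Algebra.Ring" "HOL-Computational_Algebra.Primes"
begin

definition psi_map :: "('a, 'm) ring_scheme \<Rightarrow> nat \<Rightarrow> ('a \<Rightarrow> 'a) \<Rightarrow> 'a \<Rightarrow> 'a" where
  "psi_map A p \<theta> a = a [^]\<^bsub>A\<^esub> p \<ominus>\<^bsub>A\<^esub> [p] \<cdot>\<^bsub>A\<^esub> \<theta> a"

(* The division in theta_add is exact: a prime p divides (p choose j) for 0 < j < p. *)
locale theta_ring = cring A for A (structure) +
  fixes p :: nat and \<theta> :: "'a \<Rightarrow> 'a"
  assumes prime_p: "prime p"
    and theta_closed: "\<theta> \<in> carrier A \<rightarrow> carrier A"
    and psi_hom: "psi_map A p \<theta> \<in> ring_hom A A"
    and theta_one: "\<theta> \<one> = \<zero>"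
    and theta_add: "\<lbrakk>a \<in> carrier A; b \<in> carrier A\<rbrakk> \<Longrightarrow>
      \<theta> (a \<oplus> b) = \<theta> a \<oplus> \<theta> b \<oplus>
        (\<Oplus>j \<in> {1..p - 1}. [((p choose j) div p)] \<cdot> (a [^] j \<otimes> b [^] (p - j)))"
    and theta_mult: "\<lbrakk>a \<in> carrier A; b \<in> carrier A\<rbrakk> \<Longrightarrow>
      \<theta> (a \<otimes> b) = \<theta> a \<otimes> psi_map A p \<theta> b \<oplus> a [^] p \<otimes> \<theta> b"
    and theta_psi: "a \<in> carrier A \<Longrightarrow> \<theta> (psi_map A p \<theta> a) = psi_map A p \<theta> (\<theta> a)"

end

theory Submission
  imports Defs
begin

text \<open>
  Expanding \<open>\<theta>(p\<^sup>e a) = 0\<close> by multiplicativity, with \<open>\<theta>(p\<^sup>e) = (p\<^bsup>pe\<^esup> - p\<^sup>e) / p\<close>, shows that the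
  Frobenius lift lowers the torsion exponent: \<open>p\<^bsup>e-1\<^esup> \<psi>(a) = 0\<close>. Put \<open>m = p\<^bsup>e-1\<^esup> + p\<^bsup>e-2\<^esup>\<close>. By
  induction \<open>\<psi>(a)\<^sup>m = 0\<close>, and the claim is about \<open>a\<^bsup>pm\<^esup> = (\<psi>(a) + p \<theta>(a))\<^sup>m\<close>. In the binomial
  expansion the mixed terms contain \<open>\<psi>(a)\<close> and have a coefficient divisible by \<open>p\<^bsup>e-1\<^esup>\<close>, while
  \<open>(p \<theta>(a))\<^sup>m\<close> vanishes because \<open>m > e\<close> and \<open>p\<^bsup>e+1\<^esup> \<theta>(a) = p\<^sup>e (a\<^sup>p - \<psi>(a)) = 0\<close>.
\<close>

section \<open>Binomial coefficients and powers of a prime\<close>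

lemma prime_power_Suc_dvd_choose_times_power:
  fixes p :: nat
  assumes p: "prime p" and n: "p ^ k dvd n" and i: "0 < i"
  shows "p ^ Suc k dvd (n choose i) * p ^ i"
proof -
  \<comment> \<open>Here \<open>v\<close> is the exponent of \<open>p\<close> in \<open>i\<close>.
    By the absorption identity for \<open>i * (n choose i)\<close>, at most \<open>v\<close> of the
    \<open>k\<close> factors \<open>p\<close> of \<open>n\<close> are lost in
    \<open>n choose i\<close>. Since \<open>v < p ^ v \<le> i\<close>, the factor
    \<open>p ^ i\<close> makes up the loss and adds one more \<open>p\<close>.\<close>
  obtain v r where r: "\<not> p dvd r" and iv: "i = p ^ v * r"
    using i p by (metis multiplicity_decompose' not_prime_unit neq0_conv)
  have "p ^ v \<le> i"
    using i iv by (cases r) auto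
  moreover have "v < p ^ v"
    using p by (intro power_gt_expt) (simp add: prime_gt_Suc_0_nat)
  ultimately have vi: "Suc v \<le> i" by simp
  have "p ^ k dvd i * (n choose i)"
    using n by (simp add: times_binomial_minus1_eq[OF i])
  then have "p ^ k dvd r * (p ^ v * (n choose i))"
    by (simp add: iv mult_ac)
  moreover have "coprime (p ^ k) r"
    using p r by (simp add: prime_imp_coprime)
  ultimately have "p ^ k dvd p ^ v * (n choose i)"
    by (simp add: coprime_dvd_mult_right_iff)
  then have "p ^ Suc k dvd p ^ Suc v * (n choose i)"
    by (simp add: mult.assoc)
  also have "\<dots> dvd (n choose i) * p ^ i"
    using le_imp_power_dvd[OF vi, of p] by (subst mult.commute) (rule mult_dvd_mono[OF dvd_refl])
  finally show ?thesis .
qed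

text \<open>The sum is the correction term of \<open>theta_add\<close> for the integers
  \<open>n\<close> and 1, so this identity drives the computation of \<open>\<theta>\<close> on
  multiples of \<open>\<one>\<close>.\<close>

lemma Suc_power_prime:
  fixes n p :: nat
  assumes p: "prime p"
  shows "Suc n ^ p = n ^ p + p * (\<Sum>j = 1..p - 1. ((p choose j) div p) * n ^ j) + 1"
proof -
  have "Suc n ^ p = (\<Sum>j\<le>p. (p choose j) * n ^ j)"
    using binomial[of n 1 p] by simp
  also have "{..p} = insert 0 (insert p {1..p - 1})"
    using prime_gt_0_nat[OF p] by auto
  also have "(\<Sum>j\<in>insert 0 (insert p {1..p - 1}). (p choose j) * n ^ j)
      = 1 + (n ^ p + (\<Sum>j = 1..p - 1. (p choose j) * n ^ j))"
    using prime_gt_0_nat[OF p] by simp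
  also have "(\<Sum>j = 1..p - 1. (p choose j) * n ^ j)
      = p * (\<Sum>j = 1..p - 1. ((p choose j) div p) * n ^ j)"
    unfolding sum_distrib_left
  proof (rule sum.cong[OF refl])
    fix j assume "j \<in> {1..p - 1}"
    then have "p dvd p choose j"
      using p by (intro dvd_choose_prime) auto
    then show "(p choose j) * n ^ j = p * (((p choose j) div p) * n ^ j)"
      by (metis dvd_mult_div_cancel mult.assoc)
  qed
  finally show ?thesis by simp
qed

section \<open>Integer multiples and binomial expansion in a commutative ring\<close>

context cring
begin

lemma add_pow_dvd_zero:
  fixes m n :: nat
  assumes "m dvd n" "x \<in> carrier R" "[m] \<cdot> x = \<zero>"
  shows "[n] \<cdot> x = \<zero>"
proof -
  obtain k where "n = m * k" using assms(1) by (elim dvdE)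
  then have "[n] \<cdot> x = [k] \<cdot> ([m] \<cdot> x)"
    using assms(2) by (simp add: add.nat_pow_pow)
  then show ?thesis using assms(3) by simp
qed

text \<open>Trades an integer multiple for a ring product, the form to which multiplicative laws
  such as \<open>theta_mult\<close> apply.\<close>

lemma add_pow_one_mult:
  fixes m :: nat
  assumes "x \<in> carrier R"
  shows "[m] \<cdot> \<one> \<otimes> x = [m] \<cdot> x"
  using assms by (simp add: add_pow_ldistr)

lemma add_pow_one_pow:
  fixes m n :: nat
  shows "([m] \<cdot> \<one>) [^] n = [(m ^ n)] \<cdot> \<one>"
  by (induction n) (simp_all add: add_pow_ldistr add.nat_pow_pow mult.commute)

lemma add_pow_pow:
  fixes m n :: nat
  assumes "x \<in> carrier R"
  shows "([m] \<cdot> x) [^] n = [(m ^ n)] \<cdot> (x [^] n)"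
proof -
  have "([m] \<cdot> x) [^] n = ([m] \<cdot> \<one> \<otimes> x) [^] n"
    using assms by (simp add: add_pow_one_mult)
  also have "\<dots> = [(m ^ n)] \<cdot> \<one> \<otimes> x [^] n"
    using assms by (simp add: nat_pow_distrib add_pow_one_pow)
  finally show ?thesis
    using assms by (simp add: add_pow_one_mult)
qed

lemma finsum_add_pow_one:
  fixes f :: "'c \<Rightarrow> nat"
  assumes "finite I"
  shows "(\<Oplus>i\<in>I. [(f i)] \<cdot> \<one>) = [(\<Sum>i\<in>I. f i)] \<cdot> \<one>"
  using assms by (induction I) (simp_all add: add.nat_pow_mult)

lemma binomial_cring:
  fixes n :: nat
  assumes x: "x \<in> carrier R" and y: "y \<in> carrier R"
  shows "(x \<oplus> y) [^] n = (\<Oplus>k\<in>{..n}. [(n choose k)] \<cdot> (x [^] k \<otimes> y [^] (n - k)))"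
proof (induction n)
  case 0
  show ?case by simp
next
  case (Suc n)
  note [simp] = x y
  let ?t = "\<lambda>k. x [^] Suc k \<otimes> y [^] (n - k)"
  let ?S = "\<Oplus>k\<in>{..n}. [(n choose k)] \<cdot> (x [^] k \<otimes> y [^] (n - k))"
  have "?S \<otimes> x = (\<Oplus>k\<in>{..n}. [(n choose k)] \<cdot> (x [^] k \<otimes> y [^] (n - k)) \<otimes> x)"
    by (rule finsum_ldistr) auto
  also have "\<dots> = (\<Oplus>k\<in>{..n}. [(n choose k)] \<cdot> ?t k)"
    by (rule add.finprod_cong') (auto simp: add_pow_ldistr add_pow_rdistr m_ac)
  finally have Sx: "?S \<otimes> x = (\<Oplus>k\<in>{..n}. [(n choose k)] \<cdot> ?t k)" .
  have "?S \<otimes> y = (\<Oplus>k\<in>{..n}. [(n choose k)] \<cdot> (x [^] k \<otimes> y [^] (n - k)) \<otimes> y)"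
    by (rule finsum_ldistr) auto
  also have "\<dots> = (\<Oplus>k\<in>{..n}. [(n choose k)] \<cdot> (x [^] k \<otimes> y [^] (Suc n - k)))"
    by (rule add.finprod_cong') (auto simp: add_pow_ldistr m_assoc Suc_diff_le)
  \<comment> \<open>The added top term has coefficient \<open>n choose Suc n\<close>, which is 0.
    Splitting off \<open>k = 0\<close> and shifting the index then aligns this sum with
    \<open>Sx\<close> for Pascal's rule.\<close>
  also have "\<dots> = (\<Oplus>k\<in>{..Suc n}. [(n choose k)] \<cdot> (x [^] k \<otimes> y [^] (Suc n - k)))"
    by (subst finsum_Suc) (auto simp: binomial_eq_0)
  also have "\<dots> = (\<Oplus>k\<in>{..n}. [(n choose Suc k)] \<cdot> ?t k) \<oplus> y [^] Suc n"
    by (subst finsum_Suc2) auto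
  finally have Sy: "?S \<otimes> y = (\<Oplus>k\<in>{..n}. [(n choose Suc k)] \<cdot> ?t k) \<oplus> y [^] Suc n" .
  have S: "?S \<in> carrier R" by (rule finsum_closed) auto
  have "(x \<oplus> y) [^] Suc n = ?S \<otimes> x \<oplus> ?S \<otimes> y"
    using Suc S by (simp add: r_distr)
  also have "\<dots> = ((\<Oplus>k\<in>{..n}. [(n choose k)] \<cdot> ?t k)
      \<oplus> (\<Oplus>k\<in>{..n}. [(n choose Suc k)] \<cdot> ?t k)) \<oplus> y [^] Suc n"
    unfolding Sx Sy by (rule a_assoc[symmetric]) (auto intro!: finsum_closed)
  also have "\<dots> = (\<Oplus>k\<in>{..n}. [(n choose k)] \<cdot> ?t k \<oplus> [(n choose Suc k)] \<cdot> ?t k)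
      \<oplus> y [^] Suc n"
    by (subst finsum_addf) auto
  also have "\<dots> = (\<Oplus>k\<in>{..n}. [(Suc n choose Suc k)] \<cdot> ?t k) \<oplus> y [^] Suc n"
    by (simp add: add.nat_pow_mult del: nat_pow_Suc)
  also have "\<dots> = (\<Oplus>k\<in>{..Suc n}. [(Suc n choose k)] \<cdot> (x [^] k \<otimes> y [^] (Suc n - k)))"
    by (subst finsum_Suc2) auto
  finally show ?case .
qed

text \<open>Each term of the binomial expansion vanishes on its own: the term \<open>i = 0\<close>
  by \<open>xn\<close>, the term \<open>i = n\<close> by \<open>yn\<close>, the mixed ones by
  \<open>tors\<close>. It is meant for \<open>y = \<theta> a\<close> and
  \<open>x = \<psi> a\<close>.\<close>

lemma add_prime_multiple_pow_eq_zero: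
  fixes p n k :: nat
  assumes p: "prime p" and x: "x \<in> carrier R" and y: "y \<in> carrier R"
    and n: "0 < n" "p ^ k dvd n"
    and tors: "[(p ^ Suc k)] \<cdot> x = \<zero>"
    and xn: "x [^] n = \<zero>" and yn: "[(p ^ n)] \<cdot> y = \<zero>"
  shows "([p] \<cdot> y \<oplus> x) [^] n = \<zero>"
proof -
  have "[(n choose i)] \<cdot> (([p] \<cdot> y) [^] i \<otimes> x [^] (n - i)) = \<zero>" if "i \<le> n" for i
  proof -
    consider "i = 0" | "i = n" "0 < i" | "0 < i" "i < n"
      using \<open>i \<le> n\<close> by linarith
    then show ?thesis
    proof cases
      case 1
      then show ?thesis using xn by simp
    next
      case 2
      then obtain j where j: "n = Suc j" by (cases n) auto
      have "([p] \<cdot> y) [^] n = [(p ^ n)] \<cdot> (y [^] n)"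
        using y by (rule add_pow_pow)
      also have "\<dots> = y [^] j \<otimes> [(p ^ n)] \<cdot> y"
        using y j by (simp add: add_pow_rdistr del: power_Suc)
      finally have "([p] \<cdot> y) [^] n = y [^] j \<otimes> [(p ^ n)] \<cdot> y" .
      then show ?thesis using 2 y yn by simp
    next
      case 3
      \<comment> \<open>As \<open>i < n\<close>, one factor \<open>x\<close> can be split off to
        absorb \<open>p ^ Suc k\<close>, which divides the full coefficient
        \<open>(n choose i) * p ^ i\<close>.\<close>
      obtain j where j: "n - i = Suc j" using 3 by (metis Suc_diff_Suc)
      let ?z = "y [^] i \<otimes> x [^] (n - i)"
      have "?z = (y [^] i \<otimes> x [^] j) \<otimes> x"
        using x y j by (simp add: m_assoc)
      then have "[(p ^ Suc k)] \<cdot> ?z = (y [^] i \<otimes> x [^] j) \<otimes> [(p ^ Suc k)] \<cdot> x"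
        using x y by (simp add: add_pow_rdistr)
      then have "[(p ^ Suc k)] \<cdot> ?z = \<zero>"
        using x y tors by simp
      then have "[((n choose i) * p ^ i)] \<cdot> ?z = \<zero>"
        using x y
        by (intro add_pow_dvd_zero[OF prime_power_Suc_dvd_choose_times_power[OF p n(2) 3(1)]]) simp_all
      moreover have "[(n choose i)] \<cdot> (([p] \<cdot> y) [^] i \<otimes> x [^] (n - i))
          = [((n choose i) * p ^ i)] \<cdot> ?z"
        using x y by (simp add: add_pow_pow add_pow_ldistr add.nat_pow_pow mult.commute)
      ultimately show ?thesis by simp
    qed
  qed
  then have "(\<Oplus>i\<in>{..n}. [(n choose i)] \<cdot> (([p] \<cdot> y) [^] i \<otimes> x [^] (n - i))) = \<zero>"
    by (intro add.finprod_one_eqI) auto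
  then show ?thesis
    using x y by (simp add: binomial_cring)
qed

end

section \<open>Torsion elements of a theta-ring\<close>

context theta_ring
begin

abbreviation \<psi> :: "'a \<Rightarrow> 'a" where
  "\<psi> \<equiv> psi_map A p \<theta>"

lemma theta_in_carrier [simp, intro]: "a \<in> carrier A \<Longrightarrow> \<theta> a \<in> carrier A"
  using theta_closed by auto

lemma psi_in_carrier [simp, intro]: "a \<in> carrier A \<Longrightarrow> \<psi> a \<in> carrier A"
  by (simp add: psi_map_def)

lemma theta_plus_psi: "a \<in> carrier A \<Longrightarrow> [p] \<cdot> \<theta> a \<oplus> \<psi> a = a [^] p"
  by (simp add: psi_map_def minus_eq a_ac r_neg)

lemma theta_zero: "\<theta> \<zero> = \<zero>"
proof -
  have "(\<Oplus>j\<in>{1..p - 1}. [((p choose j) div p)] \<cdot> (\<zero> [^] j \<otimes> \<zero> [^] (p - j))) = \<zero>"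
    by (intro add.finprod_one_eqI) (auto simp: nat_pow_zero)
  then have "\<theta> \<zero> = \<theta> \<zero> \<oplus> \<theta> \<zero>"
    using theta_add[of \<zero> \<zero>] by simp
  then show ?thesis
    by (metis add.l_cancel_one theta_in_carrier zero_closed)
qed

text \<open>The witness is \<open>k = (n ^ p - n) / p\<close>, described by an equation to avoid
  division and truncated subtraction.\<close>

lemma theta_add_pow_one:
  fixes n :: nat
  shows "\<exists>k. p * k + n = n ^ p \<and> \<theta> ([n] \<cdot> \<one>) = [k] \<cdot> \<one>"
proof (induction n)
  case 0
  show ?case
    using theta_zero prime_gt_0_nat[OF prime_p] by (intro exI[of _ 0]) simp
next
  case (Suc n)
  then obtain k where k: "p * k + n = n ^ p" "\<theta> ([n] \<cdot> \<one>) = [k] \<cdot> \<one>" by blast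
  define s where "s = (\<Sum>j = 1..p - 1. ((p choose j) div p) * n ^ j)"
  have "(\<Oplus>j\<in>{1..p - 1}. [((p choose j) div p)] \<cdot> (([n] \<cdot> \<one>) [^] j \<otimes> \<one> [^] (p - j)))
      = (\<Oplus>j\<in>{1..p - 1}. [(((p choose j) div p) * n ^ j)] \<cdot> \<one>)"
    by (rule add.finprod_cong')
      (auto simp: add_pow_one_pow add.nat_pow_pow mult.commute)
  also have "\<dots> = [s] \<cdot> \<one>"
    by (simp add: s_def finsum_add_pow_one)
  finally have "\<theta> ([Suc n] \<cdot> \<one>) = [(k + s)] \<cdot> \<one>"
    using theta_add[of "[n] \<cdot> \<one>" \<one>] k(2) by (simp add: theta_one add.nat_pow_mult)
  moreover have "p * (k + s) + Suc n = Suc n ^ p"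
    using Suc_power_prime[OF prime_p, of n] k(1) by (simp add: s_def algebra_simps)
  ultimately show ?case by blast
qed

lemma psi_torsion:
  assumes a: "a \<in> carrier A" and tors: "[(p ^ Suc e)] \<cdot> a = \<zero>"
  shows "[(p ^ e)] \<cdot> \<psi> a = \<zero>"
proof -
  \<comment> \<open>Chosen so that \<open>(p ^ Suc e) ^ p = p * p ^ q\<close>; then
    \<open>\<theta>\<close> sends \<open>p ^ Suc e\<close> to \<open>p ^ q - p ^ e\<close>.\<close>
  define q where "q = p * e + (p - 1)"
  have p2: "2 \<le> p" using prime_p by (rule prime_ge_2_nat)
  have Suc_q: "Suc q = Suc e * p" using p2 by (simp add: q_def algebra_simps)
  have "2 * e \<le> p * e" using p2 by (intro mult_right_mono) auto
  then have q: "Suc e \<le> q" using p2 unfolding q_def by linarith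
  have pow_q: "(p ^ Suc e) ^ p = p * p ^ q"
    by (simp only: Suc_q power_mult[symmetric] power_Suc[symmetric])
  obtain k where k: "p * k + p ^ Suc e = (p ^ Suc e) ^ p"
    and theta_k: "\<theta> ([(p ^ Suc e)] \<cdot> \<one>) = [k] \<cdot> \<one>"
    using theta_add_pow_one by blast
  have "p * (k + p ^ e) = p * p ^ q" using k pow_q by (simp add: algebra_simps)
  then have kq: "k + p ^ e = p ^ q" using p2 by simp
  have "\<zero> = \<theta> ([(p ^ Suc e)] \<cdot> \<one> \<otimes> a)"
    using a tors theta_zero by (simp add: add_pow_one_mult del: power_Suc)
  also have "\<dots> = [k] \<cdot> \<psi> a \<oplus> [(p * p ^ q)] \<cdot> \<theta> a"
    using a theta_mult[of "[(p ^ Suc e)] \<cdot> \<one>" a]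
    by (simp add: theta_k add_pow_one_pow add_pow_one_mult pow_q del: power_Suc)
  \<comment> \<open>Adding \<open>[(p ^ e)] \<cdot> \<psi> a\<close> to both sides turns the
    coefficient \<open>k\<close> into \<open>p ^ q\<close>. The right side then becomes
    \<open>p ^ q\<close> times \<open>a [^] p\<close>, which is zero because \<open>q\<close> is at
    least \<open>Suc e\<close>.\<close>
  finally have "[(p ^ e)] \<cdot> \<psi> a = [(p ^ e)] \<cdot> \<psi> a \<oplus> ([k] \<cdot> \<psi> a \<oplus> [(p * p ^ q)] \<cdot> \<theta> a)"
    using a by simp
  also have "\<dots> = [(p ^ q)] \<cdot> \<psi> a \<oplus> [(p ^ q)] \<cdot> ([p] \<cdot> \<theta> a)"
    using a by (simp add: a_assoc[symmetric] add.nat_pow_mult add.nat_pow_pow add.commute kq[symmetric])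
  also have "\<dots> = [(p ^ q)] \<cdot> ([p] \<cdot> \<theta> a \<oplus> \<psi> a)"
    using a by (simp add: add.nat_pow_distrib a_comm)
  also have "\<dots> = [(p ^ q)] \<cdot> (a [^] p)"
    using a by (simp add: theta_plus_psi)
  also have "\<dots> = a [^] (p - 1) \<otimes> [(p ^ q)] \<cdot> a"
    using a p2 by (cases p) (simp_all add: add_pow_rdistr)
  also have "[(p ^ q)] \<cdot> a = \<zero>"
    using le_imp_power_dvd[OF q] a tors by (rule add_pow_dvd_zero)
  finally show ?thesis using a by simp
qed

text \<open>The exponent is shifted to \<open>Suc e\<close> so that no predecessor occurs in the
  induction, and \<open>a\<close> varies because the induction hypothesis is applied to
  \<open>\<psi> a\<close>.\<close>

lemma torsion_imp_pow_eq_zero: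
  assumes "a \<in> carrier A" and "[(p ^ Suc e)] \<cdot> a = \<zero>"
  shows "a [^] (p ^ Suc e + p ^ e) = \<zero>"
  using assms
proof (induction e arbitrary: a)
  case 0
  then have a: "a \<in> carrier A" and tors: "[p] \<cdot> a = \<zero>" by auto
  \<comment> \<open>With \<open>\<psi> a = \<zero>\<close>, the power \<open>a [^] p\<close> equals
    \<open>[p] \<cdot> \<theta> a\<close>, and one more factor \<open>a\<close> absorbs the
    \<open>p\<close>.\<close>
  have psi: "\<psi> a = \<zero>" using psi_torsion[of a 0] 0 by simp
  have "a [^] Suc p = ([p] \<cdot> \<theta> a \<oplus> \<psi> a) \<otimes> a"
    using a by (simp add: theta_plus_psi)
  also have "\<dots> = \<theta> a \<otimes> [p] \<cdot> a"
    using a by (simp add: psi add_pow_ldistr add_pow_rdistr)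
  finally show ?case using a tors by simp
next
  case (Suc e)
  note a [simp] = Suc.prems(1)
  define n where "n = p ^ Suc e + p ^ e"
  have p2: "2 \<le> p" using prime_p by (rule prime_ge_2_nat)
  have tors: "[(p ^ Suc e)] \<cdot> \<psi> a = \<zero>"
    using Suc.prems by (rule psi_torsion)
  have psi_n: "\<psi> a [^] n = \<zero>"
    unfolding n_def using Suc.IH tors by simp
  have "Suc e < p ^ Suc e" "e < p ^ e"
    using p2 by (auto intro!: power_gt_expt simp del: power_Suc)
  then have n: "Suc (Suc (Suc e)) \<le> n" by (simp add: n_def)
  \<comment> \<open>Since \<open>p ^ Suc (Suc e)\<close> kills both \<open>a [^] p\<close> and
    \<open>\<psi> a\<close>, it kills \<open>[p] \<cdot> \<theta> a\<close>. This costs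
    \<open>\<theta> a\<close> one further power of \<open>p\<close>, which explains the bound on
    \<open>n\<close> above.\<close>
  have "[(p ^ Suc (Suc e))] \<cdot> (a [^] p) = a [^] (p - 1) \<otimes> [(p ^ Suc (Suc e))] \<cdot> a"
    using p2 by (cases p) (simp_all add: add_pow_rdistr del: power_Suc)
  then have "\<zero> = [(p ^ Suc (Suc e))] \<cdot> ([p] \<cdot> \<theta> a \<oplus> \<psi> a)"
    using Suc.prems by (simp add: theta_plus_psi del: power_Suc)
  also have "\<dots> = [(p ^ Suc (Suc e))] \<cdot> ([p] \<cdot> \<theta> a) \<oplus> [(p ^ Suc (Suc e))] \<cdot> \<psi> a"
    by (rule add.nat_pow_distrib) auto
  also have "[(p ^ Suc (Suc e))] \<cdot> \<psi> a = \<zero>"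
    by (rule add_pow_dvd_zero[OF _ _ tors]) auto
  also have "[(p ^ Suc (Suc e))] \<cdot> ([p] \<cdot> \<theta> a) \<oplus> \<zero> = [(p ^ Suc (Suc (Suc e)))] \<cdot> \<theta> a"
    by (simp add: add.nat_pow_pow)
  finally have "[(p ^ Suc (Suc (Suc e)))] \<cdot> \<theta> a = \<zero>" ..
  then have theta_n: "[(p ^ n)] \<cdot> \<theta> a = \<zero>"
    by (rule add_pow_dvd_zero[OF le_imp_power_dvd[OF n] theta_in_carrier[OF a]])
  \<comment> \<open>The choice \<open>k = e\<close> is possible because
    \<open>n = p ^ e * (p + 1)\<close>.\<close>
  have "([p] \<cdot> \<theta> a \<oplus> \<psi> a) [^] n = \<zero>"
    using prime_p n tors psi_n theta_n
    by (intro add_prime_multiple_pow_eq_zero[where k = e]) (auto simp: n_def)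
  then have "a [^] (p * n) = \<zero>"
    by (simp add: theta_plus_psi nat_pow_pow)
  then show ?case by (simp add: n_def algebra_simps)
qed

end

theorem theorem1:
  fixes A (structure) and p e :: nat and \<theta> :: "'a \<Rightarrow> 'a" and a :: 'a
  assumes "theta_ring A p \<theta>"
    and "e > 0"
    and "a \<in> carrier A"
    and "[(p ^ e)] \<cdot> a = \<zero>"
  shows "a [^] (p ^ e + p ^ (e - 1)) = \<zero>"
  using theta_ring.torsion_imp_pow_eq_zero[OF assms(1), of a "e - 1"] assms(2-4)
  by simp

end
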